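(* There exist families $\{H_{3k}\}_{k\ge 5}$ of triangulations such that, for every integer $k\ge 5$, the triangulation $H_{3k}$ has $n=3k$ vertices and $\gamma_c(H_{3k}) = k = \frac{n}{3}$.
   Context: Graphs are finite, simple and connected. A planar graph is a graph that can be drawn in the plane so that edges intersect only at their endpoints. A planar graph is maximal, or a triangulation, if adding any new edge (between two non-adjacent vertices) creates a graph that is no longer planar. A set $S\subset V(G)$ is a dominating set of $G$ if each vertex of $G$ is either in $S$ or adjacent to a vertex in $S$; it is a connected dominating set if additionally the subgraph of $G$ induced by $S$ is connected. The connected domination number $\gamma_c(G)$ is the smallest number of vertices in a connected dominating set of $G$. *)

theory Defs
  imports "HOL-Analysis.Analysis" "Graph_Theory.Graph_Theory"
begin

text \<open>
  A finite simple graph is a \<open>pair_graph\<close>: a finite loop-free symmetric digraph whose arcs are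
  pairs of vertices. An undirected edge \<open>{u, v}\<close> is thus represented by the two arcs
  \<open>(u, v)\<close> and \<open>(v, u)\<close>.
\<close>

definition uedges :: "'a pair_pre_digraph \<Rightarrow> 'a set set" where
  "uedges G = {{u, v} | u v. (u, v) \<in> parcs G}"

text \<open>
  In a drawing, \<open>p\<close> places the vertices and \<open>c\<close> assigns to each undirected edge an arc (an injective
  path) in the plane. An arc meets no vertex other than its two ends, and two arcs meet only in
  common ends.
\<close>

definition plane_drawing ::
  "'a pair_pre_digraph \<Rightarrow> ('a \<Rightarrow> complex) \<Rightarrow> ('a set \<Rightarrow> real \<Rightarrow> complex) \<Rightarrow> bool" where
  "plane_drawing G p c \<longleftrightarrow>
     inj_on p (pverts G) \<and>
     (\<forall>e\<in>uedges G. arc (c e) \<and> {pathstart (c e), pathfinish (c e)} = p ` e \<and>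
        path_image (c e) \<inter> p ` pverts G \<subseteq> p ` e) \<and>
     (\<forall>e\<in>uedges G. \<forall>f\<in>uedges G. e \<noteq> f \<longrightarrow>
        path_image (c e) \<inter> path_image (c f) \<subseteq> p ` (e \<inter> f))"

definition planar :: "'a pair_pre_digraph \<Rightarrow> bool" where
  "planar G \<longleftrightarrow> (\<exists>p c. plane_drawing G p c)"

definition add_edge :: "'a pair_pre_digraph \<Rightarrow> 'a \<Rightarrow> 'a \<Rightarrow> 'a pair_pre_digraph" where
  "add_edge G u v = G\<lparr>parcs := parcs G \<union> {(u, v), (v, u)}\<rparr>"

text \<open>
  \<open>connected\<close> alone would be ambiguous between graphs and topological spaces. The graph notion
  excludes the graph without vertices.
\<close>

definition maximal_planar :: "'a pair_pre_digraph \<Rightarrow> bool" where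
  "maximal_planar G \<longleftrightarrow>
     pair_graph G \<and> Digraph_Component.connected (with_proj G) \<and> planar G \<and>
     (\<forall>u\<in>pverts G. \<forall>v\<in>pverts G. u \<noteq> v \<and> (u, v) \<notin> parcs G \<longrightarrow> \<not> planar (add_edge G u v))"

definition dominating_set :: "'a pair_pre_digraph \<Rightarrow> 'a set \<Rightarrow> bool" where
  "dominating_set G S \<longleftrightarrow>
     S \<subseteq> pverts G \<and> (\<forall>v\<in>pverts G. v \<in> S \<or> (\<exists>u\<in>S. (u, v) \<in> parcs G))"

definition connected_dominating_set :: "'a pair_pre_digraph \<Rightarrow> 'a set \<Rightarrow> bool" where
  "connected_dominating_set G S \<longleftrightarrow>
     dominating_set G S \<and> Digraph_Component.connected (with_proj G \<restriction> S)"

definition connected_domination_number :: "'a pair_pre_digraph \<Rightarrow> nat" where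
  "connected_domination_number G = (LEAST m. \<exists>S. connected_dominating_set G S \<and> card S = m)"

end

theory Submission
  imports Defs
begin

text \<open>
  The witness is a tower of octahedra. Its vertices are the pairs of a level \<open>j < k\<close> and a colour
  \<open>a < 3\<close>, encoded as \<open>3 * j + a\<close>, and two vertices are adjacent if their colours differ and their
  levels differ by at most one. Each level is a triangle, and two consecutive levels induce an
  octahedron, in which a vertex and the vertex of the same colour on the other level are antipodal.

  The connected domination number is \<open>k\<close>. Picking one vertex per level with alternating colours
  gives a dominating path with \<open>k\<close> vertices. Conversely, a connected dominating set must reach both
  ends, so it meets every level in between, and it has at least two vertices in each of the octahedra
  at the two ends: a single vertex there would either miss its antipode on the end level or have no
  neighbour in the set.

  The tower is planar since the levels can be drawn as nested triangles, each inverted and shrunk by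
  the factor 4 relative to the one around it. All octahedra are then similar, so the absence of
  crossings reduces to one octahedron and the fact that edges enter the next triangle at corners only.

  Adding an edge destroys planarity. Let \<open>u\<close> and \<open>v\<close> be non-adjacent, with \<open>v\<close> on a later level, let
  \<open>w\<close> be the antipode of \<open>u\<close> on the next level, and let \<open>Q\<close> be the 4-cycle formed by the other
  four vertices of this octahedron. In every plane drawing the closed curve \<open>Q\<close> separates \<open>u\<close> from \<open>w\<close>
  (\<open>cycle4_separates\<close>). But \<open>v\<close> is joined to \<open>w\<close> by a path that avoids \<open>Q\<close>, so an edge between \<open>u\<close> and \<open>v\<close>
  would have to cross \<open>Q\<close>. The separation statement is a form of the non-planarity of the complete
  graph on five vertices. It follows from the Jordan curve theorem and two applications of
  Janiszewski's theorem on compact sets that do not separate two given points.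
\<close>

section \<open>Separation by a simple closed curve\<close>

text \<open>
  The plain name denotes connectivity of graphs here.
\<close>

abbreviation connected_set :: "'a::topological_space set \<Rightarrow> bool" where
  "connected_set \<equiv> topological_space_class.connected"

text \<open>
  A connected set stays connected when points of its closure are added, so \<open>D\<close> passes into \<open>W\<close> through
  the common boundary point \<open>a\<close>.
\<close>

lemma connected_component_via_frontier:
  fixes W :: "'a::real_normed_vector set"
  assumes W: "connected_set W" "W \<inter> X = {}" "z \<in> W"
    and D: "connected_set D" "D \<inter> X = {}" "v \<in> D"
    and a: "a \<in> D" "a \<in> frontier W"
  shows "connected_component (- X) v z"
proof -
  have "connected_set (insert a W)"
  proof (rule connected_intermediate_closure[OF W(1)])
    show "insert a W \<subseteq> closure W"
      using a(2) closure_subset[of W] by (simp add: frontier_def)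
  qed auto
  then have "connected_set (D \<union> insert a W)"
    using D(1) a(1) by (intro connected_Un) auto
  moreover have "D \<union> insert a W \<subseteq> - X" using W D a by auto
  ultimately show ?thesis
    unfolding connected_component_def using W(3) D(3) by blast
qed

text \<open>
  The closed curve consists of three sides, each named after the opposite corner; \<open>u\<close> is joined to the
  corners by three legs and \<open>w\<close> by three arms. If \<open>u\<close> and \<open>w\<close> were on the same side of the curve, all legs
  and arms would be there too, and there would be a point \<open>z\<close> in the component \<open>W\<close> on the other side.
  The arm to \<open>a\<close> continues into \<open>W\<close>, so \<open>w\<close> and \<open>z\<close> are not separated by the side opposite to \<open>a\<close>
  together with the legs to \<open>b\<close> and \<open>c\<close>; the same holds for the other two corners. These three closed
  curves overlap in connected sets, so by Janiszewski's theorem their union does not separate \<open>w\<close>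
  from \<open>z\<close> either. That union contains the given curve, a contradiction.
\<close>

lemma simple_closed_curve_separates_tripods:
  fixes g :: "real \<Rightarrow> complex"
  assumes g: "simple_path g" "pathfinish g = pathstart g"
    and J: "path_image g = Ca \<union> Cb \<union> Cc"
    and compact: "compact Ca" "compact Cb" "compact Cc" "compact La" "compact Lb" "compact Lc"
    and corners: "a \<in> Cb \<inter> Cc" "b \<in> Cc \<inter> Ca" "c \<in> Ca \<inter> Cb"
    and sides: "Cb \<inter> Cc \<subseteq> {a}" "Cc \<inter> Ca \<subseteq> {b}" "Ca \<inter> Cb \<subseteq> {c}"
    and opposite: "a \<notin> Ca" "b \<notin> Cb" "c \<notin> Cc"
    and legs: "connected_set La" "connected_set Lb" "connected_set Lc"
      "connected_set (La - {a})" "connected_set (Lb - {b})" "connected_set (Lc - {c})"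
      "u \<in> La" "u \<in> Lb" "u \<in> Lc" "a \<in> La" "b \<in> Lb" "c \<in> Lc"
      "La \<inter> path_image g \<subseteq> {a}" "Lb \<inter> path_image g \<subseteq> {b}" "Lc \<inter> path_image g \<subseteq> {c}"
      "La \<inter> Lb \<subseteq> {u}" "Lb \<inter> Lc \<subseteq> {u}" "Lc \<inter> La \<subseteq> {u}"
    and arms: "connected_set Da" "connected_set Db" "connected_set Dc"
      "w \<in> Da" "w \<in> Db" "w \<in> Dc" "a \<in> Da" "b \<in> Db" "c \<in> Dc"
      "Da \<inter> (path_image g \<union> La \<union> Lb \<union> Lc) \<subseteq> {a}"
      "Db \<inter> (path_image g \<union> La \<union> Lb \<union> Lc) \<subseteq> {b}"
      "Dc \<inter> (path_image g \<union> La \<union> Lb \<union> Lc) \<subseteq> {c}"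
    and off: "u \<notin> path_image g" "w \<notin> path_image g"
  shows "\<not> connected_component (- path_image g) u w"
proof
  let ?J = "path_image g"
  assume uw: "connected_component (- ?J) u w"
  have "\<exists>W. connected_set W \<and> W \<noteq> {} \<and> frontier W = ?J \<and> W \<inter> ?J = {} \<and> connected_component_set (- ?J) u \<inter> W = {}"
  proof -
    note JIO = Jordan_inside_outside[OF g]
    have comp: "connected_component_set (- ?J) u \<subseteq> inside ?J \<or> connected_component_set (- ?J) u \<subseteq> outside ?J"
    proof -
      have "connected_component_set (- ?J) u \<subseteq> inside ?J \<union> outside ?J"
        using JIO connected_component_subset[of "- ?J" u] by auto
      then show ?thesis
        using connectedD[OF connected_connected_component[of "- ?J" u], of "inside ?J" "outside ?J"] JIO by blast
    qed
    then show ?thesis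
    proof
      assume "connected_component_set (- ?J) u \<subseteq> inside ?J"
      then show ?thesis using JIO by (intro exI[of _ "outside ?J"]) blast
    next
      assume "connected_component_set (- ?J) u \<subseteq> outside ?J"
      then show ?thesis using JIO by (intro exI[of _ "inside ?J"]) blast
    qed
  qed
  then obtain W z where W: "connected_set W" "frontier W = ?J" "W \<inter> ?J = {}"
    "connected_component_set (- ?J) u \<inter> W = {}" and z: "z \<in> W" by blast
  have leg_off: "L \<inter> W = {}" if "connected_set (L - {x})" "u \<in> L" "L \<inter> ?J \<subseteq> {x}" "x \<in> ?J" for L x
  proof -
    have "L - {x} \<subseteq> connected_component_set (- ?J) u"
      using that off by (intro connected_component_maximal) auto
    then show ?thesis using W(3,4) that(4) by auto
  qed
  have inJ: "a \<in> ?J" "b \<in> ?J" "c \<in> ?J" using corners J by auto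
  have offW: "La \<inter> W = {}" "Lb \<inter> W = {}" "Lc \<inter> W = {}"
    using leg_off[OF legs(4,7,13) inJ(1)] leg_off[OF legs(5,8,14) inJ(2)] leg_off[OF legs(6,9,15) inJ(3)] by auto
  have ne: "a \<noteq> u" "b \<noteq> u" "c \<noteq> u" "a \<noteq> b" "b \<noteq> c" "c \<noteq> a" 
    using off inJ corners opposite by auto
  have sub: "Ca \<subseteq> ?J" "Cb \<subseteq> ?J" "Cc \<subseteq> ?J" using J by auto
  have na: "a \<notin> Ca \<union> Lb \<union> Lc" and nb: "b \<notin> Cb \<union> Lc \<union> La" and nc: "c \<notin> Cc \<union> La \<union> Lb"
    using ne opposite legs(13-15) inJ by auto
  let ?T = "?J \<union> La \<union> Lb \<union> Lc"
  have reach: "connected_component (- X) w z"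
    if "connected_set D" "w \<in> D" "x \<in> D" "D \<inter> ?T \<subseteq> {x}" "x \<notin> X" "X \<subseteq> ?T" "x \<in> ?J" for D x X
  proof (rule connected_component_via_frontier[of W])
    show "W \<inter> X = {}" using W(3) offW that(6) by auto
    show "D \<inter> X = {}" using that(4-6) by auto
  qed (use W z that in auto)
  have wa: "connected_component (- (Ca \<union> Lb \<union> Lc)) w z"
    by (rule reach[OF arms(1,4,7,10) na _ inJ(1)]) (use sub in auto)
  have wb: "connected_component (- (Cb \<union> Lc \<union> La)) w z"
    by (rule reach[OF arms(2,5,8,11) nb _ inJ(2)]) (use sub in auto)
  have wc: "connected_component (- (Cc \<union> La \<union> Lb)) w z"
    by (rule reach[OF arms(3,6,9,12) nc _ inJ(3)]) (use sub in auto)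
  have leg_side: "La \<inter> Ca = {}" "Lb \<inter> Cb = {}" "Lc \<inter> Cc = {}"
    "La \<inter> Cb \<subseteq> {a}" "La \<inter> Cc \<subseteq> {a}" "Lb \<inter> Cc \<subseteq> {b}" "Lb \<inter> Ca \<subseteq> {b}" "Lc \<inter> Ca \<subseteq> {c}" "Lc \<inter> Cb \<subseteq> {c}"
    using legs(13-15) opposite sub by auto
  have "(Ca \<union> Lb \<union> Lc) \<inter> (Cb \<union> Lc \<union> La) = Lc"
    using leg_side sides(3) legs(7-12,16-18) by auto
  then have cab: "connected_set ((Ca \<union> Lb \<union> Lc) \<inter> (Cb \<union> Lc \<union> La))"
    using legs(3) by metis
  have comp: "compact (Ca \<union> Lb \<union> Lc)" "compact (Cb \<union> Lc \<union> La)" "compact (Cc \<union> La \<union> Lb)"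
    "compact ((Ca \<union> Lb \<union> Lc) \<union> (Cb \<union> Lc \<union> La))"
    using compact by (simp_all add: compact_Un)
  note ab = Janiszewski[OF comp(1) compact_imp_closed[OF comp(2)] cab wa wb]
  have "((Ca \<union> Lb \<union> Lc) \<union> (Cb \<union> Lc \<union> La)) \<inter> (Cc \<union> La \<union> Lb) = La \<union> Lb"
    using leg_side sides(1,2) legs(7-12,16-18) by auto
  moreover have "connected_set (La \<union> Lb)" using legs by (intro connected_Un) auto
  ultimately have cabc: "connected_set (((Ca \<union> Lb \<union> Lc) \<union> (Cb \<union> Lc \<union> La)) \<inter> (Cc \<union> La \<union> Lb))"
    by metis
  have "connected_component (- (((Ca \<union> Lb \<union> Lc) \<union> (Cb \<union> Lc \<union> La)) \<union> (Cc \<union> La \<union> Lb))) w z"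
    by (rule Janiszewski[OF comp(4) compact_imp_closed[OF comp(3)] cabc ab wc])
  then have "connected_component (- ?J) w z"
    by (rule connected_component_of_subset) (auto simp: J)
  with uw have "z \<in> connected_component_set (- ?J) u"
    by (simp add: connected_component_trans[OF uw])
  with W z show False by blast
qed

section \<open>Plane drawings and 4-cycles\<close>

context
  fixes G :: "'a pair_pre_digraph" and p c
  assumes drawing: "plane_drawing G p c"
begin

lemma drawing_inj: "p x = p y \<longleftrightarrow> x = y" if "x \<in> pverts G" "y \<in> pverts G"
  using drawing that by (auto simp: plane_drawing_def dest: inj_onD)

text \<open>
  A drawing gives an undirected edge an arc of unknown orientation; here the arc may be traversed from
  either end.
\<close>

lemma drawing_arc:
  assumes "{x, y} \<in> uedges G"
  obtains g where "arc g" "pathstart g = p x" "pathfinish g = p y" "path_image g = path_image (c {x, y})"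
proof -
  have g: "arc (c {x, y})" and ends: "{pathstart (c {x, y}), pathfinish (c {x, y})} = {p x, p y}"
    using drawing assms by (auto simp: plane_drawing_def)
  from ends consider "pathstart (c {x, y}) = p x" "pathfinish (c {x, y}) = p y"
    | "pathstart (c {x, y}) = p y" "pathfinish (c {x, y}) = p x"
    by (auto simp: doubleton_eq_iff)
  then show thesis
  proof cases
    case 1
    then show ?thesis using g that by blast
  next
    case 2
    then show ?thesis using g that[of "reversepath (c {x, y})"] by (simp add: arc_reversepath)
  qed
qed

lemma drawing_end: "p x \<in> path_image (c {x, y})" "p y \<in> path_image (c {x, y})"
  if "{x, y} \<in> uedges G"
  using drawing_arc[OF that] by (metis pathstart_in_path_image pathfinish_in_path_image)+

lemma drawing_edge_minus_end:
  assumes "{x, y} \<in> uedges G"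
  shows "connected_set (path_image (c {x, y}) - {p y})"
proof -
  obtain g where g: "arc g" "pathfinish g = p y" "path_image g = path_image (c {x, y})"
    using drawing_arc[OF assms] by metis
  have "path_image g - {p y} = g ` {0..<1}"
  proof -
    have "inj_on g {0..1}" using g(1) by (simp add: arc_def)
    then have "g ` ({0..1} - {1}) = g ` {0..1} - g ` {1}"
      by (rule inj_on_image_set_diff) auto
    moreover have "{0..1} - {1::real} = {0..<1}" by auto
    ultimately show ?thesis using g(2) by (simp add: path_image_def pathfinish_def)
  qed
  moreover have "continuous_on {0..<1} g"
    using g(1) by (auto simp: arc_def path_def intro: continuous_on_subset)
  ultimately show ?thesis
    using g(3) connected_continuous_image[of "{0..<1}" g] by simp
qed

lemma drawing_edge_connected:
  assumes "{x, y} \<in> uedges G"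
  shows "compact (path_image (c {x, y}))" "connected_set (path_image (c {x, y}))"
  using drawing_arc[OF assms] by (metis arc_imp_path compact_path_image connected_path_image)+

lemma drawing_edges_meet:
  assumes "e \<in> uedges G" "f \<in> uedges G" "e \<noteq> f"
  shows "path_image (c e) \<inter> path_image (c f) \<subseteq> p ` (e \<inter> f)"
  using drawing assms by (simp add: plane_drawing_def)

lemma drawing_vertex_on_edge:
  assumes "e \<in> uedges G" "e \<subseteq> pverts G" "x \<in> pverts G" "p x \<in> path_image (c e)"
  shows "x \<in> e"
proof -
  have "p x \<in> p ` e" using drawing assms unfolding plane_drawing_def by blast
  then show ?thesis using assms drawing_inj by blast
qed

definition cycle4_image where
  "cycle4_image x1 x2 x3 x4 = path_image (c {x1, x2}) \<union> path_image (c {x2, x3})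
     \<union> path_image (c {x3, x4}) \<union> path_image (c {x4, x1})"

text \<open>
  Three consecutive corners of the 4-cycle serve as the corners of a closed curve with three sides, the
  fourth corner lying in the interior of a side. The edges at \<open>u\<close> and \<open>w\<close> provide legs and arms.
\<close>

lemma cycle4_separates:
  assumes dist: "distinct [x1, x2, x3, x4, u, w]"
    and verts: "{x1, x2, x3, x4, u, w} \<subseteq> pverts G"
    and cyc: "{x1, x2} \<in> uedges G" "{x2, x3} \<in> uedges G" "{x3, x4} \<in> uedges G" "{x4, x1} \<in> uedges G"
    and u: "{u, x1} \<in> uedges G" "{u, x2} \<in> uedges G" "{u, x3} \<in> uedges G"
    and w: "{w, x1} \<in> uedges G" "{w, x2} \<in> uedges G" "{w, x3} \<in> uedges G"
  shows "\<not> connected_component (- cycle4_image x1 x2 x3 x4) (p u) (p w)"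
proof -
  define E where "E x y = path_image (c {x, y})" for x y
  note meet = drawing_edges_meet[of "{x, y}" "{z, t}" for x y z t, folded E_def]
  obtain g12 where g12: "arc g12" "pathstart g12 = p x1" "pathfinish g12 = p x2" "path_image g12 = E x1 x2"
    using drawing_arc[OF cyc(1)] by (auto simp: E_def)
  obtain g23 where g23: "arc g23" "pathstart g23 = p x2" "pathfinish g23 = p x3" "path_image g23 = E x2 x3"
    using drawing_arc[OF cyc(2)] by (auto simp: E_def)
  obtain g34 where g34: "arc g34" "pathstart g34 = p x3" "pathfinish g34 = p x4" "path_image g34 = E x3 x4"
    using drawing_arc[OF cyc(3)] by (auto simp: E_def)
  obtain g41 where g41: "arc g41" "pathstart g41 = p x4" "pathfinish g41 = p x1" "path_image g41 = E x4 x1"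
    using drawing_arc[OF cyc(4)] by (auto simp: E_def)
  have m1: "E x1 x2 \<inter> E x2 x3 \<subseteq> {p x2}" using meet[OF cyc(1,2)] dist by auto
  have m2: "E x2 x3 \<inter> E x3 x4 \<subseteq> {p x3}" using meet[OF cyc(2,3)] dist by auto
  have m3: "E x3 x4 \<inter> E x4 x1 \<subseteq> {p x4}" using meet[OF cyc(3,4)] dist by auto
  have m4: "E x4 x1 \<inter> E x1 x2 \<subseteq> {p x1}" using meet[OF cyc(4,1)] dist by auto
  have m5: "E x1 x2 \<inter> E x3 x4 = {}" using meet[OF cyc(1,3)] dist by auto
  have m6: "E x2 x3 \<inter> E x4 x1 = {}" using meet[OF cyc(2,4)] dist by auto
  define g where "g = (g12 +++ g23) +++ (g34 +++ g41)"
  have J: "path_image g = cycle4_image x1 x2 x3 x4"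
    using g12 g23 g34 g41 by (simp add: g_def path_image_join cycle4_image_def E_def Un_assoc)
  have "arc (g12 +++ g23)" using g12 g23 m1 by (intro arc_join) auto
  moreover have "arc (g34 +++ g41)" using g34 g41 m3 by (intro arc_join) auto
  ultimately have g: "simple_path g"
    unfolding g_def using g12 g23 g34 g41 m2 m4 m5 m6
    by (intro simple_path_join_loop) (auto simp: path_image_join)
  have loop: "pathfinish g = pathstart g" using g12 g41 by (simp add: g_def)
  have J': "path_image g = E x2 x3 \<union> (E x3 x4 \<union> E x4 x1) \<union> E x1 x2"
    unfolding J cycle4_image_def E_def by auto
  have leg: "E v x1 \<inter> path_image g \<subseteq> {p x1}" "E v x2 \<inter> path_image g \<subseteq> {p x2}" "E v x3 \<inter> path_image g \<subseteq> {p x3}"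
    if "{v, x1} \<in> uedges G" "{v, x2} \<in> uedges G" "{v, x3} \<in> uedges G" "v \<notin> {x1, x2, x3, x4}" for v
  proof -
    have "E v x1 \<inter> E x1 x2 \<subseteq> {p x1}" "E v x1 \<inter> E x2 x3 \<subseteq> {p x1}" "E v x1 \<inter> E x3 x4 \<subseteq> {p x1}" "E v x1 \<inter> E x4 x1 \<subseteq> {p x1}"
      using meet[OF that(1) cyc(1)] meet[OF that(1) cyc(2)] meet[OF that(1) cyc(3)] meet[OF that(1) cyc(4)] that(4) dist
      by (auto simp: doubleton_eq_iff)
    then show "E v x1 \<inter> path_image g \<subseteq> {p x1}" unfolding J' by blast
    have "E v x2 \<inter> E x1 x2 \<subseteq> {p x2}" "E v x2 \<inter> E x2 x3 \<subseteq> {p x2}" "E v x2 \<inter> E x3 x4 \<subseteq> {p x2}" "E v x2 \<inter> E x4 x1 \<subseteq> {p x2}"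
      using meet[OF that(2) cyc(1)] meet[OF that(2) cyc(2)] meet[OF that(2) cyc(3)] meet[OF that(2) cyc(4)] that(4) dist
      by (auto simp: doubleton_eq_iff)
    then show "E v x2 \<inter> path_image g \<subseteq> {p x2}" unfolding J' by blast
    have "E v x3 \<inter> E x1 x2 \<subseteq> {p x3}" "E v x3 \<inter> E x2 x3 \<subseteq> {p x3}" "E v x3 \<inter> E x3 x4 \<subseteq> {p x3}" "E v x3 \<inter> E x4 x1 \<subseteq> {p x3}"
      using meet[OF that(3) cyc(1)] meet[OF that(3) cyc(2)] meet[OF that(3) cyc(3)] meet[OF that(3) cyc(4)] that(4) dist
      by (auto simp: doubleton_eq_iff)
    then show "E v x3 \<inter> path_image g \<subseteq> {p x3}" unfolding J' by blast
  qed
  have nu: "u \<notin> {x1, x2, x3, x4}" and nw: "w \<notin> {x1, x2, x3, x4}" using dist by auto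
  note legu = leg[OF u nu] and legw = leg[OF w nw]
  have tri: "E u x1 \<inter> E u x2 \<subseteq> {p u}" "E u x2 \<inter> E u x3 \<subseteq> {p u}" "E u x3 \<inter> E u x1 \<subseteq> {p u}"
    using meet[OF u(1,2)] meet[OF u(2,3)] meet[OF u(3,1)] dist by (auto simp: doubleton_eq_iff)
  have arm1: "E w x1 \<inter> E u x1 \<subseteq> {p x1}" "E w x1 \<inter> E u x2 \<subseteq> {p x1}" "E w x1 \<inter> E u x3 \<subseteq> {p x1}"
    using meet[OF w(1) u(1)] meet[OF w(1) u(2)] meet[OF w(1) u(3)] dist by (auto simp: doubleton_eq_iff)
  have arm2: "E w x2 \<inter> E u x1 \<subseteq> {p x2}" "E w x2 \<inter> E u x2 \<subseteq> {p x2}" "E w x2 \<inter> E u x3 \<subseteq> {p x2}"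
    using meet[OF w(2) u(1)] meet[OF w(2) u(2)] meet[OF w(2) u(3)] dist by (auto simp: doubleton_eq_iff)
  have arm3: "E w x3 \<inter> E u x1 \<subseteq> {p x3}" "E w x3 \<inter> E u x2 \<subseteq> {p x3}" "E w x3 \<inter> E u x3 \<subseteq> {p x3}"
    using meet[OF w(3) u(1)] meet[OF w(3) u(2)] meet[OF w(3) u(3)] dist by (auto simp: doubleton_eq_iff)
  have off: "p v \<notin> path_image g" if "v \<in> pverts G" "v \<notin> {x1, x2, x3, x4}" for v
    unfolding J' E_def using that verts cyc drawing_vertex_on_edge[of _ v] by auto
  note con = drawing_edge_connected[folded E_def] and minus = drawing_edge_minus_end[folded E_def]
    and ends = drawing_end[folded E_def]
  show ?thesis
    unfolding J[symmetric]
  proof (rule simple_closed_curve_separates_tripods[OF g loop J'])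
    show "p x1 \<notin> E x2 x3" "p x2 \<notin> E x3 x4 \<union> E x4 x1" "p x3 \<notin> E x1 x2"
      unfolding E_def using verts cyc drawing_vertex_on_edge[of _ x1] drawing_vertex_on_edge[of _ x2]
        drawing_vertex_on_edge[of _ x3] dist by auto
    show "p u \<notin> path_image g" "p w \<notin> path_image g" using off nu nw verts by auto
    show "compact (E x3 x4 \<union> E x4 x1)" using con cyc by (intro compact_Un) auto
    show "(E x3 x4 \<union> E x4 x1) \<inter> E x1 x2 \<subseteq> {p x1}" "E x2 x3 \<inter> (E x3 x4 \<union> E x4 x1) \<subseteq> {p x3}"
      using m5 m4 m2 m6 by auto
    show "E w x1 \<inter> (path_image g \<union> E u x1 \<union> E u x2 \<union> E u x3) \<subseteq> {p x1}" using legw(1) arm1 by blast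
    show "E w x2 \<inter> (path_image g \<union> E u x1 \<union> E u x2 \<union> E u x3) \<subseteq> {p x2}" using legw(2) arm2 by blast
    show "E w x3 \<inter> (path_image g \<union> E u x1 \<union> E u x2 \<union> E u x3) \<subseteq> {p x3}" using legw(3) arm3 by blast
    show "p x1 \<in> (E x3 x4 \<union> E x4 x1) \<inter> E x1 x2" "p x2 \<in> E x1 x2 \<inter> E x2 x3" "p x3 \<in> E x2 x3 \<inter> (E x3 x4 \<union> E x4 x1)"
      using ends cyc by auto
  qed (use m1 cyc u w con minus ends legu tri in \<open>assumption | simp\<close>)+
qed

text \<open>
  In a drawing, a walk in the graph that avoids the vertices of the cycle avoids its image, because
  edges meet in common ends only.
\<close>

lemma drawing_walk_avoids_cycle4:
  assumes reach: "(\<lambda>x y. (x, y) \<in> parcs G \<and> x \<notin> {x1, x2, x3, x4} \<and> y \<notin> {x1, x2, x3, x4})\<^sup>*\<^sup>* v w"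
    and cyc: "{x1, x2} \<in> uedges G" "{x2, x3} \<in> uedges G" "{x3, x4} \<in> uedges G" "{x4, x1} \<in> uedges G"
    and v: "v \<in> pverts G" "v \<notin> {x1, x2, x3, x4}" and verts: "{x1, x2, x3, x4} \<subseteq> pverts G"
  shows "connected_component (- cycle4_image x1 x2 x3 x4) (p v) (p w)"
  using reach
proof (induction rule: rtranclp_induct)
  case base
  then show ?case
    using v verts cyc drawing_vertex_on_edge[of _ v]
    by (auto simp: cycle4_image_def)
next
  case (step y z)
  have yz: "{y, z} \<in> uedges G" using step by (auto simp: uedges_def)
  have "path_image (c {y, z}) \<inter> path_image (c e) = {}" if "e \<in> uedges G" "e \<subseteq> {x1, x2, x3, x4}" for e
  proof -
    have "e \<noteq> {y, z}" using that(2) step(2) by auto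
    then have "path_image (c {y, z}) \<inter> path_image (c e) \<subseteq> p ` ({y, z} \<inter> e)"
      using drawing_edges_meet[OF yz that(1)] by auto
    moreover have "{y, z} \<inter> e = {}" using that(2) step(2) by auto
    ultimately show ?thesis by auto
  qed
  then have "path_image (c {y, z}) \<subseteq> - cycle4_image x1 x2 x3 x4"
    unfolding cycle4_image_def using cyc by (auto; blast)
  then have "connected_component (- cycle4_image x1 x2 x3 x4) (p y) (p z)"
    using drawing_edge_connected(2)[OF yz] drawing_end[OF yz] unfolding connected_component_def by blast
  with step.IH show ?case by (rule connected_component_trans)
qed

end

section \<open>The tower of octahedra\<close>

text \<open>
  The vertex \<open>v\<close> has level \<open>v div 3\<close> and colour \<open>v mod 3\<close>.
\<close>

definition octahedral_tower :: "nat \<Rightarrow> nat pair_pre_digraph" where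
  "octahedral_tower n = \<lparr>pverts = {..<n},
     parcs = {(u, v). u < n \<and> v < n \<and> u mod 3 \<noteq> v mod 3 \<and> u div 3 \<le> Suc (v div 3) \<and> v div 3 \<le> Suc (u div 3)}\<rparr>"

lemma pverts_tower [simp]: "pverts (octahedral_tower n) = {..<n}"
  by (simp add: octahedral_tower_def)

lemma tower_arc_iff:
  "(u, v) \<in> parcs (octahedral_tower n) \<longleftrightarrow>
     u < n \<and> v < n \<and> u mod 3 \<noteq> v mod 3 \<and> u div 3 \<le> Suc (v div 3) \<and> v div 3 \<le> Suc (u div 3)"
  by (simp add: octahedral_tower_def)

lemma tower_arc_sym: "(u, v) \<in> parcs (octahedral_tower n) \<Longrightarrow> (v, u) \<in> parcs (octahedral_tower n)"
  by (auto simp: tower_arc_iff)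

lemma tower_arcI:
  assumes "3 * i + a < n" "3 * j + b < n" "a < 3" "b < 3" "a \<noteq> b" "i \<le> Suc j" "j \<le> Suc i"
  shows "(3 * i + a, 3 * j + b) \<in> parcs (octahedral_tower n)"
  using assms by (simp add: tower_arc_iff)

lemma pair_graph_tower: "pair_graph (octahedral_tower n)"
proof unfold_locales
  have "parcs (octahedral_tower n) \<subseteq> {..<n} \<times> {..<n}" by (auto simp: tower_arc_iff)
  then show "finite (parcs (octahedral_tower n))" by (rule finite_subset) auto
  show "symmetric (with_proj (octahedral_tower n))"
    by (auto simp: symmetric_def sym_def dest: tower_arc_sym)
qed (auto simp: tower_arc_iff)

section \<open>Connectivity of induced subgraphs\<close>

text \<open>
  Symmetrising and restricting the arcs, as the definition of connectivity does, changes nothing for a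
  symmetric relation and walks inside \<open>S\<close>.
\<close>

lemma rtrancl_on_symcl_induced:
  assumes "sym r"
  shows "rtrancl_on S ((r \<inter> S \<times> S)\<^sup>s) = rtrancl_on S r"
proof -
  have eq: "(r \<inter> S \<times> S)\<^sup>s = r \<inter> S \<times> S"
    using assms by (auto simp: symcl_def sym_def)
  have "(a, b) \<in> rtrancl_on S (r \<inter> S \<times> S) \<longleftrightarrow> (a, b) \<in> rtrancl_on S r" for a b
  proof
    assume "(a, b) \<in> rtrancl_on S (r \<inter> S \<times> S)"
    then show "(a, b) \<in> rtrancl_on S r"
      by (induction rule: rtrancl_on_induct) (auto intro: rtrancl_on_into_rtrancl_on)
  next
    assume "(a, b) \<in> rtrancl_on S r"
    then show "(a, b) \<in> rtrancl_on S (r \<inter> S \<times> S)"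
      by (induction rule: rtrancl_on_induct) (auto intro: rtrancl_on_into_rtrancl_on)
  qed
  then show ?thesis unfolding eq by auto
qed

lemma connected_induced_iff:
  assumes "sym (parcs G)"
  shows "Digraph_Component.connected (with_proj G \<restriction> S) \<longleftrightarrow>
    S \<noteq> {} \<and> (\<forall>u\<in>S. \<forall>v\<in>S. (u, v) \<in> rtrancl_on S (parcs G))"
proof -
  have "arcs_ends (with_proj G \<restriction> S) = parcs G \<inter> S \<times> S"
    by (auto simp: arcs_ends_def arc_to_ends_def)
  then show ?thesis
    by (simp add: connected_conv rtrancl_on_symcl_induced[OF assms])
qed

lemma connected_if_connected_dominating_set:
  assumes G: "pair_graph G" and S: "connected_dominating_set G S"
  shows "Digraph_Component.connected (with_proj G)"
proof -
  interpret pair_graph G by (rule G)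
  have sym: "sym (parcs G)" using pair_sym_arcs by (simp add: symmetric_def)
  have sub: "S \<subseteq> pverts G" and dom: "\<And>v. v \<in> pverts G \<Longrightarrow> v \<in> S \<or> (\<exists>u\<in>S. (u, v) \<in> parcs G)"
    and con: "S \<noteq> {}" "\<And>u v. u \<in> S \<Longrightarrow> v \<in> S \<Longrightarrow> (u, v) \<in> rtrancl_on S (parcs G)"
    using S connected_induced_iff[OF sym] by (auto simp: connected_dominating_set_def dominating_set_def)
  let ?R = "rtrancl_on (pverts G) (parcs G)"
  have mono: "(u, v) \<in> ?R" if "(u, v) \<in> rtrancl_on S (parcs G)" for u v
    using that sub by (induction rule: rtrancl_on_induct) (auto intro: rtrancl_on_into_rtrancl_on)
  obtain s where s: "s \<in> S" using con by auto
  have to_s: "(s, v) \<in> ?R \<and> (v, s) \<in> ?R" if v: "v \<in> pverts G" for v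
  proof (cases "v \<in> S")
    case True
    then show ?thesis using con(2) s mono by auto
  next
    case False
    then obtain u where u: "u \<in> S" "(u, v) \<in> parcs G" using dom v by auto
    then have vu: "(v, u) \<in> parcs G" using sym by (auto simp: sym_def)
    have "(s, u) \<in> ?R" "(u, s) \<in> ?R" using con(2) s u(1) mono by auto
    then show ?thesis
      using rtrancl_on_into_rtrancl_on[OF _ u(2) v] converse_rtrancl_on_into_rtrancl_on[OF vu _ v] by blast
  qed
  have "with_proj G = with_proj G \<restriction> pverts G"
    unfolding induce_subgraph_def with_proj_def using in_arcsD1 in_arcsD2 by (auto intro: prod_cases)
  moreover have "Digraph_Component.connected (with_proj G \<restriction> pverts G)"
    unfolding connected_induced_iff[OF sym] using to_s s sub by (blast intro: rtrancl_on_trans)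
  ultimately show ?thesis by metis
qed

section \<open>Connected dominating sets of the tower\<close>

text \<open>
  The colours alternate between 0 and 1 so that consecutive vertices are adjacent.
\<close>

definition spine :: "nat \<Rightarrow> nat set" where
  "spine k = (\<lambda>j. 3 * j + j mod 2) ` {..<k}"

lemma sym_tower: "sym (parcs (octahedral_tower n))"
  by (auto simp: sym_def tower_arc_sym)

lemma card_spine: "card (spine k) = k"
proof -
  have "inj_on (\<lambda>j::nat. 3 * j + j mod 2) {..<k}"
    by (rule inj_on_inverseI[of _ "\<lambda>v. v div 3"]) auto
  then show ?thesis by (simp add: spine_def card_image)
qed

text \<open>
  Each spine vertex is adjacent to the other two vertices of its level and to the next spine vertex.
\<close>

lemma connected_dominating_set_spine:
  assumes k: "2 \<le> k"
  shows "connected_dominating_set (octahedral_tower (3 * k)) (spine k)"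
proof -
  let ?p = "\<lambda>j::nat. 3 * j + j mod 2" and ?A = "parcs (octahedral_tower (3 * k))"
  have bound: "?p j < 3 * k" if "j < k" for j using that by presburger
  have arc: "(?p j, ?p (Suc j)) \<in> ?A" if "Suc j < k" for j
    using bound[of j] bound[of "Suc j"] that by (intro tower_arcI) (auto simp: mod_Suc)
  have up: "(?p 0, ?p j) \<in> rtrancl_on (spine k) ?A \<and> (?p j, ?p 0) \<in> rtrancl_on (spine k) ?A" if "j < k" for j
    using that
  proof (induction j)
    case 0
    then show ?case by (auto simp: spine_def intro!: rtrancl_on_refl image_eqI[of _ _ 0])
  next
    case (Suc j)
    have mem: "?p (Suc j) \<in> spine k" using Suc.prems unfolding spine_def by blast
    have a: "(?p j, ?p (Suc j)) \<in> ?A" "(?p (Suc j), ?p j) \<in> ?A"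
      using arc[OF Suc.prems] tower_arc_sym by blast+
    have IH: "(?p 0, ?p j) \<in> rtrancl_on (spine k) ?A" "(?p j, ?p 0) \<in> rtrancl_on (spine k) ?A"
      using Suc by auto
    show ?case
      using rtrancl_on_into_rtrancl_on[OF IH(1) a(1) mem] converse_rtrancl_on_into_rtrancl_on[OF a(2) IH(2) mem] by blast
  qed
  have con: "Digraph_Component.connected (with_proj (octahedral_tower (3 * k)) \<restriction> spine k)"
    unfolding connected_induced_iff[OF sym_tower]
  proof (intro conjI ballI)
    show "spine k \<noteq> {}" using card_spine[of k] k by auto
    show "(u, v) \<in> rtrancl_on (spine k) ?A" if "u \<in> spine k" "v \<in> spine k" for u v
    proof -
      obtain i j where "i < k" "j < k" "u = ?p i" "v = ?p j" using \<open>u \<in> spine k\<close> \<open>v \<in> spine k\<close> by (auto simp: spine_def)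
      then have "(u, ?p 0) \<in> rtrancl_on (spine k) ?A" "(?p 0, v) \<in> rtrancl_on (spine k) ?A"
        using up by blast+
      then show ?thesis by (rule rtrancl_on_trans)
    qed
  qed
  have "v \<in> spine k \<or> (\<exists>u\<in>spine k. (u, v) \<in> ?A)" if v: "v < 3 * k" for v
  proof -
    define j where "j = v div 3"
    define a where "a = v mod 3"
    have va: "v = 3 * j + a" "a < 3" by (simp_all add: j_def a_def)
    have j: "j < k" using v by (simp add: j_def less_mult_imp_div_less mult.commute)
    show ?thesis
    proof (cases "a = j mod 2")
      case True
      then show ?thesis using va j by (auto simp: spine_def)
    next
      case False
      have "(?p j, v) \<in> ?A"
        unfolding va(1) using va False v bound[OF j] by (intro tower_arcI) auto
      moreover have "?p j \<in> spine k" using j unfolding spine_def by blast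
      ultimately show ?thesis by blast
    qed
  qed
  moreover have "spine k \<subseteq> {..<3 * k}" using bound by (auto simp: spine_def)
  ultimately show ?thesis
    using con by (auto simp: connected_dominating_set_def dominating_set_def)
qed

definition level_part :: "nat set \<Rightarrow> nat \<Rightarrow> nat set" where
  "level_part S j = {v \<in> S. v div 3 = j}"

context
  fixes k :: nat and S :: "nat set"
  assumes k: "4 \<le> k" and S: "connected_dominating_set (octahedral_tower (3 * k)) S"
begin

lemma cds_bound: "v \<in> S \<Longrightarrow> v < 3 * k"
  using S by (auto simp: connected_dominating_set_def dominating_set_def)

lemma cds_dominates:
  assumes "v < 3 * k"
  obtains "v \<in> S" | u where "u \<in> S" "(u, v) \<in> parcs (octahedral_tower (3 * k))"
  using S assms by (auto simp: connected_dominating_set_def dominating_set_def)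

lemma cds_connected: "u \<in> S \<Longrightarrow> v \<in> S \<Longrightarrow> (u, v) \<in> rtrancl_on S (parcs (octahedral_tower (3 * k)))"
  using S unfolding connected_dominating_set_def connected_induced_iff[OF sym_tower] by blast

lemma cds_near_level:
  assumes "j < k"
  obtains s where "s \<in> S" "s div 3 \<le> Suc j" "j \<le> Suc (s div 3)"
proof -
  have "3 * j < 3 * k" using assms by simp
  then show thesis
    by (rule cds_dominates) (use that in \<open>auto simp: tower_arc_iff\<close>)
qed

text \<open>
  Adjacent vertices lie on equal or consecutive levels, so a walk from one end of the tower to the
  other cannot skip a level.
\<close>

lemma cds_meets_inner_level:
  assumes "2 \<le> j" "j + 2 < k"
  shows "level_part S j \<noteq> {}"
proof
  assume empty: "level_part S j = {}"
  obtain s where s: "s \<in> S" "s div 3 \<le> 1" using cds_near_level[of 0] k by auto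
  obtain t where t: "t \<in> S" "k - 1 \<le> Suc (t div 3)" using cds_near_level[of "k - 1"] k by auto
  have "x div 3 < j" if "(s, x) \<in> rtrancl_on S (parcs (octahedral_tower (3 * k)))" for x
    using that
  proof (induction rule: rtrancl_on_induct)
    case base
    then show ?case using s assms by simp
  next
    case (step y z)
    then have "z div 3 \<le> Suc (y div 3)" "z div 3 \<noteq> j" using empty by (auto simp: tower_arc_iff level_part_def)
    then show ?case using step by simp
  qed
  then show False using cds_connected[OF s(1) t(1)] t(2) assms by fastforce
qed

text \<open>
  This is applied to both ends, with \<open>e\<close> the end level and \<open>e'\<close> the level next to it. Some \<open>s\<close> from these
  two levels dominates a vertex on the end level. If \<open>s\<close> is on \<open>e'\<close>, the vertex of \<open>e\<close> with the colour of
  \<open>s\<close> requires a different dominator; if \<open>s\<close> is on \<open>e\<close>, connectivity gives it a neighbour in \<open>S\<close>, which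
  is again on one of the two levels.
\<close>

lemma cds_meets_end_twice:
  assumes e: "e < k" "e' < k" "e \<noteq> e'"
    and nbr: "\<And>u v. (u, v) \<in> parcs (octahedral_tower (3 * k)) \<Longrightarrow> v div 3 = e \<Longrightarrow> u div 3 \<in> {e, e'}"
  shows "2 \<le> card (level_part S e \<union> level_part S e')"
proof -
  let ?E = "level_part S e \<union> level_part S e'"
  have fin: "finite ?E"
    by (rule finite_subset[of _ "{..<3 * k}"]) (auto simp: level_part_def cds_bound)
  have dominator: "\<exists>s\<in>?E. s = 3 * e + a \<or> (s, 3 * e + a) \<in> parcs (octahedral_tower (3 * k))" if "a < 3" for a
  proof -
    have "3 * e + a < 3 * k" using e that by simp
    then show ?thesis
    proof (rule cds_dominates)
      assume "3 * e + a \<in> S"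
      then show ?thesis using that by (auto simp: level_part_def)
    next
      fix u assume u: "u \<in> S" "(u, 3 * e + a) \<in> parcs (octahedral_tower (3 * k))"
      then have "u div 3 \<in> {e, e'}" using nbr[OF u(2)] that by simp
      then show ?thesis using u by (auto simp: level_part_def)
    qed
  qed
  obtain s where s: "s \<in> ?E" using dominator[of 0] by auto
  have "\<exists>t\<in>?E. t \<noteq> s"
  proof (cases "s div 3 = e'")
    case True
    obtain t where "t \<in> ?E" "t = 3 * e + s mod 3 \<or> (t, 3 * e + s mod 3) \<in> parcs (octahedral_tower (3 * k))"
      using dominator[of "s mod 3"] by auto
    moreover from this(2) have "t \<noteq> s" using True e by (auto simp: tower_arc_iff)
    ultimately show ?thesis by blast
  next
    case False
    then have se: "s \<in> S" "s div 3 = e" using s by (auto simp: level_part_def)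
    (* vertices of S near the two ends show that S has an element other than s *)
    obtain x where x: "x \<in> S" "x div 3 \<le> 1" using cds_near_level[of 0] k by auto
    obtain y where y: "y \<in> S" "k - 1 \<le> Suc (y div 3)" using cds_near_level[of "k - 1"] k by auto
    have "x \<noteq> y" using x y k by auto
    then obtain t where t: "t \<in> S" "t \<noteq> s" using x y by auto
    from cds_connected[OF t(1) se(1)] t(2) obtain r where "r \<in> S" "(r, s) \<in> parcs (octahedral_tower (3 * k))"
      by (cases rule: rtrancl_on.cases) (auto dest: in_rtrancl_on_in_F)
    then show ?thesis using nbr[of r s] se by (intro bexI[of _ r]) (auto simp: level_part_def tower_arc_iff)
  qed
  then obtain t where t: "t \<in> ?E" "t \<noteq> s" by blast
  have "card {s, t} \<le> card ?E" using s t fin by (intro card_mono) auto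
  then show ?thesis using t by simp
qed

text \<open>
  The two ends contribute at least \<open>2 + 2\<close> elements and the \<open>k - 4\<close> levels in between at least one each.
\<close>

lemma card_cds_ge: "k \<le> card S"
proof -
  have finS: "finite S" by (rule finite_subset[of _ "{..<3 * k}"]) (auto simp: cds_bound)
  have finL: "finite (level_part S j)" for j using finS by (simp add: level_part_def)
  have disj: "level_part S i \<inter> level_part S j = {}" if "i \<noteq> j" for i j using that by (auto simp: level_part_def)
  let ?B = "level_part S 0 \<union> level_part S 1" and ?T = "level_part S (k - 1) \<union> level_part S (k - 2)"
    and ?M = "\<Union>j\<in>{2..<k-2}. level_part S j"
  have B: "2 \<le> card ?B"
    by (rule cds_meets_end_twice) (use k in \<open>auto simp: tower_arc_iff\<close>)
  have T: "2 \<le> card ?T"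
  proof (rule cds_meets_end_twice)
    fix u v assume uv: "(u, v) \<in> parcs (octahedral_tower (3 * k))" "v div 3 = k - 1"
    then have "u div 3 < k" "k - 1 \<le> Suc (u div 3)" by (auto simp: tower_arc_iff)
    then show "u div 3 \<in> {k - 1, k - 2}" using k by auto
  qed (use k in auto)
  have "card ?M = (\<Sum>j\<in>{2..<k-2}. card (level_part S j))"
    using finL disj by (intro card_UN_disjoint) auto
  also have "\<dots> \<ge> (\<Sum>j\<in>{2..<k-2}. 1)"
    using cds_meets_inner_level finL by (intro sum_mono) (auto simp: Suc_le_eq card_gt_0_iff)
  finally have M: "k - 4 \<le> card ?M" by simp
  have "?B \<inter> ?M = {}" "(?B \<union> ?M) \<inter> ?T = {}" using k by (auto simp: level_part_def)
  then have "card (?B \<union> ?M \<union> ?T) = card ?B + card ?M + card ?T"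
    using finL by (subst card_Un_disjoint; simp?)+
  moreover have "card (?B \<union> ?M \<union> ?T) \<le> card S"
    using finS by (intro card_mono) (auto simp: level_part_def)
  ultimately show ?thesis using B T M k by linarith
qed

end

lemma connected_domination_number_tower:
  assumes "4 \<le> k"
  shows "connected_domination_number (octahedral_tower (3 * k)) = k"
  unfolding connected_domination_number_def
proof (rule Least_equality)
  show "\<exists>S. connected_dominating_set (octahedral_tower (3 * k)) S \<and> card S = k"
    using connected_dominating_set_spine card_spine assms by (intro exI[of _ "spine k"]) auto
qed (use card_cds_ge[OF assms] in auto)

section \<open>Adding an edge destroys planarity\<close>

text \<open>
  \<open>Q\<close> consists of the vertices on the levels \<open>i\<close> and \<open>i + 1\<close> whose colour is not \<open>a\<close>. A vertex on a higher
  level can descend one level at a time to level \<open>i + 2\<close>, changing its colour in each step; on that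
  level, each colour other than \<open>a\<close> is adjacent to the target.
\<close>

lemma tower_walk_above_cycle:
  fixes i k a b b' :: nat
  assumes abc: "a < 3" "b < 3" "b' < 3" "a \<noteq> b" "b \<noteq> b'" "b' \<noteq> a" and n: "i + 1 < k"
  defines "Q \<equiv> {3 * i + b, 3 * i + b', 3 * (i + 1) + b, 3 * (i + 1) + b'}"
  defines "R \<equiv> \<lambda>x y. (x, y) \<in> parcs (octahedral_tower (3 * k)) \<and> x \<notin> Q \<and> y \<notin> Q"
  assumes v: "v < 3 * k" "i + 1 \<le> v div 3" "v \<notin> Q"
  shows "R\<^sup>*\<^sup>* v (3 * (i + 1) + a)"
proof -
  let ?w = "3 * (i + 1) + a"
  have offQ: "3 * j + e \<notin> Q" if "i + 2 \<le> j" for j e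
    using that abc unfolding Q_def by auto
  have wQ: "?w \<notin> Q" using abc unfolding Q_def by auto
  have other: "\<exists>f<3. f \<noteq> e" for e :: nat by presburger
  have up: "R\<^sup>*\<^sup>* (3 * j + e) ?w" if "i + 2 \<le> j" "j < k" "e < 3" for j e
    using that
  proof (induction j arbitrary: e rule: dec_induct)
    case base
    have direct: "R (3 * (i + 2) + f) ?w" if "f < 3" "f \<noteq> a" for f
      unfolding R_def using offQ[of "i + 2"] wQ base n abc(1) that by (intro conjI tower_arcI) auto
    show ?case
    proof (cases "e = a")
      case True
      obtain f where f: "f < 3" "f \<noteq> a" using other by blast
      then have "R (3 * (i + 2) + e) (3 * (i + 2) + f)"
        unfolding R_def using offQ[of "i + 2"] base True by (intro conjI tower_arcI) auto
      with direct[OF f] show ?thesis by (meson converse_rtranclp_into_rtranclp r_into_rtranclp)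
    next
      case False
      then show ?thesis using direct base by blast
    qed
  next
    case (step j)
    obtain f where f: "f < 3" "f \<noteq> e" using other by blast
    then have "R (3 * Suc j + e) (3 * j + f)"
      unfolding R_def using offQ[of j] offQ[of "Suc j"] step by (intro conjI tower_arcI) auto
    then show ?case using step.IH[of f] step.prems f by (meson converse_rtranclp_into_rtranclp Suc_lessD)
  qed
  show ?thesis
  proof (cases "v div 3 = i + 1")
    case True
    have eq: "v = 3 * (i + 1) + v mod 3" using True by presburger
    moreover have "v mod 3 = a"
    proof (rule ccontr)
      assume "v mod 3 \<noteq> a"
      moreover have "v mod 3 < 3" by simp
      ultimately have "v mod 3 = b \<or> v mod 3 = b'" using abc by linarith
      then show False using v(3) eq unfolding Q_def by auto
    qed
    ultimately show ?thesis by simp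
  next
    case False
    have "R\<^sup>*\<^sup>* (3 * (v div 3) + v mod 3) ?w" using False v by (intro up) auto
    then show ?thesis by simp
  qed
qed

text \<open>
  The 4-cycle runs through the octahedron on the levels of \<open>u\<close> and its successor, avoiding \<open>u\<close> and its
  antipode \<open>w\<close>. It separates \<open>u\<close> from \<open>w\<close> in a drawing, whereas the new edge followed by the walk from
  \<open>v\<close> to \<open>w\<close> joins them.
\<close>

lemma tower_add_edge_not_planar_less:
  assumes uv: "u < v" "v < 3 * k" and nadj: "(u, v) \<notin> parcs (octahedral_tower (3 * k))"
  shows "\<not> planar (add_edge (octahedral_tower (3 * k)) u v)"
proof
  let ?G = "octahedral_tower (3 * k)"
  let ?H = "add_edge ?G u v"
  assume "planar ?H"
  then obtain p c where d: "plane_drawing ?H p c" by (auto simp: planar_def)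
  define i where "i = u div 3"
  define a where "a = u mod 3"
  define w where "w = 3 * (i + 1) + a"
  have u: "u = 3 * i + a" by (simp add: i_def a_def)
  have a: "a < 3" by (simp add: a_def)
  obtain b b' where "b < 3" "b' < 3" "a \<noteq> b" "b \<noteq> b'" "b' \<noteq> a"
  proof -
    consider "a = 0" | "a = 1" | "a = 2" using a by linarith
    then show thesis using that[of 1 2] that[of 0 2] that[of 0 1] by cases auto
  qed
  note abc = a this
  have vi: "i + 1 \<le> v div 3"
  proof (rule ccontr)
    assume "\<not> i + 1 \<le> v div 3"
    then have "v div 3 = u div 3" using uv(1) div_le_mono[of u v 3] by (simp add: i_def)
    moreover from this have "v mod 3 \<noteq> u mod 3" using uv(1) by (metis div_mult_mod_eq nat_neq_iff)
    ultimately show False using nadj uv by (auto simp: tower_arc_iff)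
  qed
  have ik: "i + 1 < k" using vi uv(2) by (metis le_less_trans less_mult_imp_div_less mult.commute)
  let ?x1 = "3 * i + b" and ?x2 = "3 * i + b'" and ?x3 = "3 * (i + 1) + b" and ?x4 = "3 * (i + 1) + b'"
  have vQ: "v \<notin> {?x1, ?x2, ?x3, ?x4}"
  proof
    assume "v \<in> {?x1, ?x2, ?x3, ?x4}"
    then obtain j e where "v = 3 * j + e" "e \<in> {b, b'}" "j \<le> i + 1" by force
    then have "v mod 3 \<noteq> a" "v div 3 \<le> i + 1" using abc by auto
    then show False using nadj uv vi by (auto simp: tower_arc_iff i_def a_def)
  qed
  have uQ: "u \<notin> {?x1, ?x2, ?x3, ?x4}" using abc u by auto
  have GH: "{x, y} \<in> uedges ?H" if "(x, y) \<in> parcs ?G" for x y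
    using that by (auto simp: uedges_def add_edge_def)
  have arcs: "(3 * i' + e, 3 * j' + f) \<in> parcs ?G"
    if "i' \<in> {i, i + 1}" "j' \<in> {i, i + 1}" "e < 3" "f < 3" "e \<noteq> f" for i' j' e f
    using that ik by (intro tower_arcI) auto
  have cyc: "{?x1, ?x2} \<in> uedges ?H" "{?x2, ?x3} \<in> uedges ?H" "{?x3, ?x4} \<in> uedges ?H" "{?x4, ?x1} \<in> uedges ?H"
    by (rule GH, rule arcs; use abc in simp)+
  have ux: "{u, ?x1} \<in> uedges ?H" "{u, ?x2} \<in> uedges ?H" "{u, ?x3} \<in> uedges ?H"
    using GH[OF arcs[of i i a b]] GH[OF arcs[of i i a b']] GH[OF arcs[of i "i + 1" a b]] abc
    by (simp_all add: u[symmetric])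
  have wx: "{w, ?x1} \<in> uedges ?H" "{w, ?x2} \<in> uedges ?H" "{w, ?x3} \<in> uedges ?H"
    unfolding w_def by (rule GH, rule arcs; use abc in simp)+
  have vertsH: "pverts (add_edge ?G x y) = {..<3 * k}" for x y by (simp add: add_edge_def)
  have verts: "{?x1, ?x2, ?x3, ?x4, u, w} \<subseteq> pverts ?H"
    unfolding vertsH u w_def using abc ik by simp
  have dist: "distinct [?x1, ?x2, ?x3, ?x4, u, w]"
    unfolding u w_def using abc by auto
  let ?R = "\<lambda>x y. (x, y) \<in> parcs ?H \<and> x \<notin> {?x1, ?x2, ?x3, ?x4} \<and> y \<notin> {?x1, ?x2, ?x3, ?x4}"
  have walk: "?R\<^sup>*\<^sup>* v w"
    using tower_walk_above_cycle[OF abc ik uv(2) vi vQ] unfolding w_def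
    by (rule rtranclp_mono[THEN predicate2D, rotated]) (auto simp: add_edge_def)
  have "?R u v" using uQ vQ by (simp add: add_edge_def)
  then have "?R\<^sup>*\<^sup>* u w" using walk by (rule converse_rtranclp_into_rtranclp[of ?R])
  then have "connected_component (- cycle4_image c ?x1 ?x2 ?x3 ?x4) (p u) (p w)"
    using verts uQ by (intro drawing_walk_avoids_cycle4[OF d _ cyc]) auto
  with cycle4_separates[OF d dist verts cyc ux wx] show False by contradiction
qed

lemma tower_add_edge_not_planar:
  assumes "u < 3 * k" "v < 3 * k" "u \<noteq> v" "(u, v) \<notin> parcs (octahedral_tower (3 * k))"
  shows "\<not> planar (add_edge (octahedral_tower (3 * k)) u v)"
proof (cases "u < v")
  case True
  then show ?thesis using assms tower_add_edge_not_planar_less by blast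
next
  case False
  then have "\<not> planar (add_edge (octahedral_tower (3 * k)) v u)"
    using assms by (intro tower_add_edge_not_planar_less) (auto dest: tower_arc_sym)
  moreover have "add_edge (octahedral_tower (3 * k)) v u = add_edge (octahedral_tower (3 * k)) u v"
    by (simp add: add_edge_def insert_commute)
  ultimately show ?thesis by simp
qed

section \<open>A straight-line drawing of the tower\<close>

text \<open>
  The corners sum to zero, so multiplication by a negative number turns their triangle upside down
  about its centroid; their size makes the coordinates on the first two levels integers.
\<close>

definition corner :: "nat \<Rightarrow> complex" where
  "corner a = (if a = 0 then 4 else if a = 1 then 4 * \<i> else - 4 - 4 * \<i>)"

definition place :: "nat \<Rightarrow> complex" where
  "place v = (- 1 / 4) ^ (v div 3) *\<^sub>R corner (v mod 3)"

text \<open>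
  The triangle spanned by the corners, as an intersection of half-planes.
\<close>

definition corner_triangle :: "complex set" where
  "corner_triangle = {z. Complex 1 1 \<bullet> z \<le> 4} \<inter> {z. Complex (- 2) 1 \<bullet> z \<le> 4} \<inter> {z. Complex 1 (- 2) \<bullet> z \<le> 4}"

lemma mem_corner_triangle:
  "z \<in> corner_triangle \<longleftrightarrow> Re z + Im z \<le> 4 \<and> Im z - 2 * Re z \<le> 4 \<and> Re z - 2 * Im z \<le> 4"
  by (auto simp: corner_triangle_def inner_complex_def)

definition level_triangle :: "nat \<Rightarrow> complex set" where
  "level_triangle j = {z. (- 4) ^ j *\<^sub>R z \<in> corner_triangle}"

text \<open>
  Together with the bound on the levels this describes an edge of the tower, or a single vertex if
  \<open>u = v\<close>, so that edges and vertices can be treated alike.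
\<close>

definition cell :: "nat \<Rightarrow> nat \<Rightarrow> bool" where
  "cell u v \<longleftrightarrow> u = v \<or> u mod 3 \<noteq> v mod 3"

lemma place_shift: "place (3 * j + x) = (- 1 / 4) ^ j *\<^sub>R place x"
  by (simp add: place_def power_add)

lemma place_level_0_1:
  "Re (place 0) = 4" "Im (place 0) = 0" "Re (place (Suc 0)) = 0" "Im (place (Suc 0)) = 4"
  "Re (place 2) = - 4" "Im (place 2) = - 4" "Re (place 3) = - 1" "Im (place 3) = 0"
  "Re (place 4) = 0" "Im (place 4) = - 1" "Re (place 5) = 1" "Im (place 5) = 1"
  by (simp_all add: place_def corner_def)

lemma less_6_cases:
  assumes "(x::nat) < 6"
  obtains "x = 0" | "x = 1" | "x = 2" | "x = 3" | "x = 4" | "x = 5"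
  using assms by linarith

lemma segment_coords:
  assumes "w \<in> closed_segment a b"
  obtains s where "0 \<le> s" "s \<le> 1" "Re w = Re a + s * (Re b - Re a)" "Im w = Im a + s * (Im b - Im a)"
proof -
  obtain s where s: "0 \<le> s" "s \<le> 1" and w: "w = (1 - s) *\<^sub>R a + s *\<^sub>R b"
    using assms by (auto simp: in_segment)
  show thesis by (rule that[OF s]) (simp_all add: w algebra_simps)
qed

text \<open>
  The vertices below 6 form the outermost octahedron, whose drawing has fixed integer coordinates, so
  the absence of crossings is a finite check.
\<close>

lemma layer_0_meet:
  assumes "x < 6" "y < 6" "cell x y" "x' < 6" "y' < 6" "cell x' y'"
    and w: "w \<in> closed_segment (place x) (place y)" "w \<in> closed_segment (place x') (place y')"
  shows "{x, y} = {x', y'} \<or> (x \<in> {x', y'} \<and> w = place x) \<or> (y \<in> {x', y'} \<and> w = place y)"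
proof -
  have main: "{x, y} = {x', y'} \<or> (x \<in> {x', y'} \<and> w = place x) \<or> (y \<in> {x', y'} \<and> w = place y)"
    if xy: "x \<le> y" "x' \<le> y'" "x < 6" "y < 6" "x' < 6" "y' < 6" "cell x y" "cell x' y'"
      and w: "w \<in> closed_segment (place x) (place y)" "w \<in> closed_segment (place x') (place y')" for x y x' y'
  proof -
    obtain s where s: "0 \<le> s" "s \<le> 1" "Re w = Re (place x) + s * (Re (place y) - Re (place x))"
      "Im w = Im (place x) + s * (Im (place y) - Im (place x))"
      using segment_coords[OF w(1)] .
    obtain t where t: "0 \<le> t" "t \<le> 1" "Re w = Re (place x') + t * (Re (place y') - Re (place x'))"
      "Im w = Im (place x') + t * (Im (place y') - Im (place x'))"
      using segment_coords[OF w(2)] .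
    let ?cells = "{(0,0), (1,1), (2,2), (3,3), (4,4), (5,5), (0,1), (0,2), (1,2), (0,4), (0,5), (1,3), (1,5),
      (2,3), (2,4), (3,4), (3,5), (4,5)} :: (nat \<times> nat) set"
    (* for each pair of cells the two parametrisations of w form a linear system in s and t *)
    have "(x, y) \<in> ?cells"
      using xy(1,3,4,7) unfolding cell_def by (elim less_6_cases) simp_all
    moreover have "(x', y') \<in> ?cells"
      using xy(2,5,6,8) unfolding cell_def by (elim less_6_cases) simp_all
    ultimately show ?thesis
      using s t unfolding complex_eq_iff insert_iff empty_iff prod.inject
      by (elim disjE conjE FalseE) (simp_all add: place_level_0_1 doubleton_eq_iff)
  qed
  have sym: "cell y x" "cell y' x'" using assms(3,6) by (auto simp: cell_def)
  have w': "w \<in> closed_segment (place y) (place x)" "w \<in> closed_segment (place y') (place x')"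
    using w by (simp_all add: closed_segment_commute)
  consider "x \<le> y" "x' \<le> y'" | "y \<le> x" "x' \<le> y'" | "x \<le> y" "y' \<le> x'" | "y \<le> x" "y' \<le> x'"
    by linarith
  then show ?thesis
    using main[of x y x' y'] main[of y x x' y'] main[of x y y' x'] main[of y x y' x'] assms sym w'
    by cases (simp_all add: insert_commute, blast+)
qed


lemma place_unshift: "(- 4) ^ j *\<^sub>R place (3 * j + x) = place x"
  by (simp add: place_shift flip: power_mult_distrib)

text \<open>
  Going up by \<open>j\<close> levels scales the drawing, which reduces all octahedra to the outermost one.
\<close>

lemma segment_unshift:
  "w \<in> closed_segment (place (3 * j + x)) (place (3 * j + y)) \<longleftrightarrow>
   (- 4) ^ j *\<^sub>R w \<in> closed_segment (place x) (place y)"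
proof -
  let ?f = "\<lambda>z::complex. (- 4 :: real) ^ j *\<^sub>R z"
  have "closed_segment (?f (place (3 * j + x))) (?f (place (3 * j + y))) =
      ?f ` closed_segment (place (3 * j + x)) (place (3 * j + y))"
    by (intro closed_segment_linear_image linear_scaleR)
  moreover have "inj ?f" by (auto simp: inj_def)
  ultimately show ?thesis
    by (simp add: place_unshift inj_image_mem_iff)
qed

lemma layer_meet:
  assumes "x < 6" "y < 6" "cell x y" "x' < 6" "y' < 6" "cell x' y'"
    and w: "w \<in> closed_segment (place (3 * j + x)) (place (3 * j + y))"
      "w \<in> closed_segment (place (3 * j + x')) (place (3 * j + y'))"
  shows "{x, y} = {x', y'} \<or> (x \<in> {x', y'} \<and> w = place (3 * j + x)) \<or> (y \<in> {x', y'} \<and> w = place (3 * j + y))"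
proof -
  have "(w = place (3 * j + z)) \<longleftrightarrow> (- 4) ^ j *\<^sub>R w = place z" for z
    by (subst place_unshift[of j z, symmetric]) simp
  then show ?thesis
    using layer_0_meet[OF assms(1-6)] w unfolding segment_unshift by blast
qed

lemma segment_in_level_triangle:
  assumes "x < 6" "y < 6"
  shows "closed_segment (place (3 * j + x)) (place (3 * j + y)) \<subseteq> level_triangle j"
proof
  fix w assume "w \<in> closed_segment (place (3 * j + x)) (place (3 * j + y))"
  then have "(- 4) ^ j *\<^sub>R w \<in> closed_segment (place x) (place y)" by (simp add: segment_unshift)
  moreover have "place z \<in> corner_triangle" if "z < 6" for z
    using that by (elim less_6_cases) (simp_all add: mem_corner_triangle place_level_0_1)
  moreover have "convex corner_triangle"
    unfolding corner_triangle_def by (intro convex_Int convex_halfspace_le)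
  ultimately show "w \<in> level_triangle j"
    using assms closed_segment_subset[of "place x" corner_triangle "place y"] by (auto simp: level_triangle_def)
qed

lemma level_triangle_antimono:
  assumes "i \<le> j"
  shows "level_triangle j \<subseteq> level_triangle i"
  using assms
proof (induction rule: dec_induct)
  case (step n)
  have "z \<in> corner_triangle" if "- (4 *\<^sub>R z) \<in> corner_triangle" for z
    using that by (simp add: mem_corner_triangle)
  then have "level_triangle (Suc n) \<subseteq> level_triangle n"
    by (auto simp: level_triangle_def)
  with step.IH show ?case by blast
qed auto

text \<open>
  The edges of level \<open>j\<close> stay away from the next triangle because it has only a quarter of the size of
  theirs, and the edges between the two levels reach a corner of it from outside. So only the edges of
  level \<open>j + 1\<close> itself have more than an end in common with that triangle.
\<close>

lemma segment_meets_next_level_triangle: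
  assumes "x < 6" "y < 6" "cell x y"
    and w: "w \<in> closed_segment (place (3 * j + x)) (place (3 * j + y))" "w \<in> level_triangle (Suc j)"
  shows "(3 \<le> x \<and> 3 \<le> y) \<or> (3 \<le> x \<and> w = place (3 * j + x)) \<or> (3 \<le> y \<and> w = place (3 * j + y))"
proof -
  define z where "z = (- 4) ^ j *\<^sub>R w"
  have eq: "(w = place (3 * j + x)) \<longleftrightarrow> z = place x" for x
    unfolding z_def by (subst place_unshift[of j x, symmetric]) simp
  have "z \<in> closed_segment (place x) (place y)" using w(1) by (simp add: segment_unshift z_def)
  then obtain s where s: "0 \<le> s" "s \<le> 1" "Re z = Re (place x) + s * (Re (place y) - Re (place x))"
    "Im z = Im (place x) + s * (Im (place y) - Im (place x))"
    by (rule segment_coords)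
  have "- (4 *\<^sub>R z) \<in> corner_triangle" using w(2) by (simp add: level_triangle_def z_def)
  then have c: "- Re z - Im z \<le> 1" "- Im z + 2 * Re z \<le> 1" "- Re z + 2 * Im z \<le> 1"
    by (simp_all add: mem_corner_triangle)
  have "(3 \<le> x \<and> 3 \<le> y) \<or> (3 \<le> x \<and> z = place x) \<or> (3 \<le> y \<and> z = place y)"
    using assms(1-3) s c unfolding complex_eq_iff cell_def
    by (elim less_6_cases) (simp_all add: place_level_0_1)
  then show ?thesis unfolding eq .
qed

text \<open>
  Let the first cell start at level \<open>i\<close> and the second at level \<open>j\<close>. If \<open>i < j\<close>, the second lies in the
  triangle of level \<open>i + 1\<close>. Hence either the first cell can be regarded as a cell starting at level
  \<open>i + 1\<close>, or the common point \<open>w\<close> is an end of it on this level, and this end is itself such a cell.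
  Repeating this leads to two cells of the same octahedron.
\<close>

lemma tower_cells_meet_ordered:
  assumes "i \<le> j" "x < 6" "y < 6" "cell x y" "x' < 6" "y' < 6" "cell x' y'"
    and w: "w \<in> closed_segment (place (3 * i + x)) (place (3 * i + y))"
      "w \<in> closed_segment (place (3 * j + x')) (place (3 * j + y'))"
  shows "{3 * i + x, 3 * i + y} = {3 * j + x', 3 * j + y'} \<or>
    w \<in> place ` ({3 * i + x, 3 * i + y} \<inter> {3 * j + x', 3 * j + y'})"
  using assms(1-4) w(1)
proof (induction arbitrary: x y rule: inc_induct)
  case base
  then show ?case using layer_meet[of x y x' y' w j] assms(5-) by auto
next
  case (step i)
  have "w \<in> level_triangle (Suc i)"
    using segment_in_level_triangle[OF assms(5,6)] w(2) level_triangle_antimono[of "Suc i" j] step.hyps by auto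
  then consider "3 \<le> x" "3 \<le> y" | "3 \<le> x" "w = place (3 * i + x)" | "3 \<le> y" "w = place (3 * i + y)"
    using segment_meets_next_level_triangle[OF step.prems] by blast
  then show ?case
  proof cases
    case 1
    have "cell (x - 3) (y - 3)" using 1 step.prems(3) le_mod_geq[of 3 x] le_mod_geq[of 3 y] by (auto simp: cell_def)
    moreover have "3 * Suc i + (x - 3) = 3 * i + x" "3 * Suc i + (y - 3) = 3 * i + y" using 1 by auto
    ultimately show ?thesis using step.IH[of "x - 3" "y - 3"] step.prems by auto
  next
    case 2
    have eq: "3 * Suc i + (x - 3) = 3 * i + x" using 2 by auto
    have "{3 * i + x, 3 * i + x} = {3 * j + x', 3 * j + y'} \<or>
        w \<in> place ` ({3 * i + x, 3 * i + x} \<inter> {3 * j + x', 3 * j + y'})"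
      using step.IH[of "x - 3" "x - 3"] step.prems 2 unfolding eq by (simp add: cell_def)
    then show ?thesis using 2(2) by blast
  next
    case 3
    have eq: "3 * Suc i + (y - 3) = 3 * i + y" using 3 by auto
    have "{3 * i + y, 3 * i + y} = {3 * j + x', 3 * j + y'} \<or>
        w \<in> place ` ({3 * i + y, 3 * i + y} \<inter> {3 * j + x', 3 * j + y'})"
      using step.IH[of "y - 3" "y - 3"] step.prems 3 unfolding eq by (simp add: cell_def)
    then show ?thesis using 3(2) by blast
  qed
qed

definition tower_cell :: "nat \<Rightarrow> nat \<Rightarrow> bool" where
  "tower_cell u v \<longleftrightarrow> cell u v \<and> u div 3 \<le> Suc (v div 3) \<and> v div 3 \<le> Suc (u div 3)"

lemma tower_cellE:
  assumes "tower_cell u v"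
  obtains i x y where "u = 3 * i + x" "v = 3 * i + y" "x < 6" "y < 6" "cell x y"
proof -
  define i where "i = min (u div 3) (v div 3)"
  have lev: "i \<le> u div 3" "i \<le> v div 3" "u div 3 \<le> i + 1" "v div 3 \<le> i + 1"
    using assms by (auto simp: i_def tower_cell_def)
  have offset: "3 * i \<le> z" "z < 3 * i + 6" if "i \<le> z div 3" "z div 3 \<le> i + 1" for z
  proof -
    have "z = 3 * (z div 3) + z mod 3" "z mod 3 < 3" by simp_all
    then show "3 * i \<le> z" "z < 3 * i + 6" using that by linarith+
  qed
  obtain x y where xy: "u = 3 * i + x" "v = 3 * i + y"
    using offset lev by (metis le_Suc_ex)
  moreover have "x < 6" "y < 6" using offset[of u] offset[of v] lev xy by simp_all
  moreover have "cell x y" using assms xy unfolding tower_cell_def cell_def by auto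
  ultimately show thesis using that by blast
qed

lemma tower_cells_meet:
  assumes "tower_cell u v" "tower_cell u' v'"
    and w: "w \<in> closed_segment (place u) (place v)" "w \<in> closed_segment (place u') (place v')"
  shows "{u, v} = {u', v'} \<or> w \<in> place ` ({u, v} \<inter> {u', v'})"
proof -
  obtain i x y where uv: "u = 3 * i + x" "v = 3 * i + y" "x < 6" "y < 6" "cell x y"
    using tower_cellE[OF assms(1)] .
  obtain j x' y' where uv': "u' = 3 * j + x'" "v' = 3 * j + y'" "x' < 6" "y' < 6" "cell x' y'"
    using tower_cellE[OF assms(2)] .
  show ?thesis
  proof (cases "i \<le> j")
    case True
    show ?thesis
      using tower_cells_meet_ordered[OF True uv(3-5) uv'(3-5)] w unfolding uv uv' by blast
  next
    case False
    then have "j \<le> i" by simp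
    show ?thesis
      using tower_cells_meet_ordered[OF \<open>j \<le> i\<close> uv'(3-5) uv(3-5)] w unfolding uv uv' by blast
  qed
qed

lemma planar_tower: "planar (octahedral_tower n)"
proof -
  let ?G = "octahedral_tower n"
  define c where "c e = linepath (place (Min e)) (place (Max e))" for e
  have image: "path_image (c {u, v}) = closed_segment (place u) (place v)" for u v
    by (cases "u \<le> v") (auto simp: c_def min_def max_def closed_segment_commute)
  have arc: "tower_cell u v \<and> u \<noteq> v" if "(u, v) \<in> parcs ?G" for u v
    using that by (auto simp: tower_arc_iff tower_cell_def cell_def)
  have vertex: "tower_cell u u" for u by (simp add: tower_cell_def cell_def)
  have inj: "u = v" if "place u = place v" for u v
    using tower_cells_meet[OF vertex vertex, of "place u" u v] that by auto
  have "plane_drawing ?G place c"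
    unfolding plane_drawing_def
  proof (intro conjI ballI impI)
    show "inj_on place (pverts ?G)" using inj by (rule inj_onI)
  next
    fix e assume "e \<in> uedges ?G"
    then obtain u v where e: "e = {u, v}" and uv: "(u, v) \<in> parcs ?G" by (auto simp: uedges_def)
    show "arc (c e)" "{pathstart (c e), pathfinish (c e)} = place ` e"
      using arc[OF uv] inj by (auto simp: c_def e min_def max_def intro!: arc_linepath)
    have "place z \<in> place ` e" if "place z \<in> closed_segment (place u) (place v)" for z
      using tower_cells_meet[OF vertex, of u v "place z" z] arc[OF uv] that e by auto
    then show "path_image (c e) \<inter> place ` pverts ?G \<subseteq> place ` e"
      unfolding e image by blast
  next
    fix e f assume "e \<in> uedges ?G" "f \<in> uedges ?G" and ne: "e \<noteq> f"
    then obtain u v u' v' where e: "e = {u, v}" "(u, v) \<in> parcs ?G" and f: "f = {u', v'}" "(u', v') \<in> parcs ?G"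
      by (auto simp: uedges_def)
    show "path_image (c e) \<inter> path_image (c f) \<subseteq> place ` (e \<inter> f)"
      using tower_cells_meet[of u v u' v'] arc[OF e(2)] arc[OF f(2)] ne unfolding e(1) f(1) image by blast
  qed
  then show ?thesis by (auto simp: planar_def)
qed

theorem proposition12:
  shows "\<exists>H :: nat \<Rightarrow> nat pair_pre_digraph. \<forall>k\<ge>5.
    maximal_planar (H (3 * k)) \<and>
    card (pverts (H (3 * k))) = 3 * k \<and>
    connected_domination_number (H (3 * k)) = k \<and>
    real k = real (card (pverts (H (3 * k)))) / 3"
proof (intro exI[of _ octahedral_tower] allI impI conjI)
  fix k :: nat
  assume k: "5 \<le> k"
  show "maximal_planar (octahedral_tower (3 * k))"
    unfolding maximal_planar_def
    using k pair_graph_tower planar_tower tower_add_edge_not_planar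
      connected_if_connected_dominating_set[OF pair_graph_tower connected_dominating_set_spine]
    by simp
  show "connected_domination_number (octahedral_tower (3 * k)) = k"
    using k by (intro connected_domination_number_tower) simp
qed simp_all

end
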